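(* Let $Y$ be a graph that is a generalized truncation of some multigraph. If $Y$ has a unique isolating perfect matching $M$, and for any two distinct components of $Y\setminus M$ there is at least one edge of $M$ joining them, then $|\mathrm{src}(Y)|=1$.
   Context: A multigraph may have multiple edges but no loops; a graph has neither loops nor multiple edges. Multigraphs from which generalized truncations are formed are assumed to have no isolated vertices. Generalized truncation: let $X$ be a multigraph. Take a matching $M_0$ with $|M_0|=|E(X)|$ (on $2|E(X)|$ new vertices) and a bijection $F:E(X)\to M_0$; for each edge $e$ of $X$ with ends $u,v$, label one end of $F(e)$ by $u$ and the other by $v$. For $v\in V(X)$, the cluster $\mathrm{cl}(v)$ is the set of vertices labelled $v$; insert an arbitrary graph $\mathrm{con}(v)$ on $\mathrm{cl}(v)$. The graph $F(M_0)\cup\bigcup_v\mathrm{con}(v)$, and any graph isomorphic to it, is a generalized truncation of $X$. For a graph $Y$, the source $\mathrm{src}(Y)$ is the set of multigraphs $X$ (without loops, considered up to isomorphism) such that $Y$ is a generalized truncation of $X$. $Y\setminus M$ denotes $Y$ with the edges of $M$ deleted. A perfect matching $M$ of $Y$ is isolating if no edge of $M$ has both end vertices in the same component of $Y\setminus M$. *)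

theory Defs
  imports Main
begin

record 'a graph =
  gverts :: "'a set"
  gedges :: "'a set set"

definition is_graph :: "'a graph \<Rightarrow> bool" where
  "is_graph Y \<longleftrightarrow> (\<forall>e \<in> gedges Y. e \<subseteq> gverts Y \<and> card e = 2)"

definition graph_iso :: "'a graph \<Rightarrow> 'b graph \<Rightarrow> bool" where
  "graph_iso Y Z \<longleftrightarrow>
     (\<exists>f. bij_betw f (gverts Y) (gverts Z) \<and> gedges Z = (\<lambda>e. f ` e) ` gedges Y)"

definition delete_edges :: "'a graph \<Rightarrow> 'a set set \<Rightarrow> 'a graph" where
  "delete_edges Y M = Y\<lparr>gedges := gedges Y - M\<rparr>"

definition connected_rel :: "'a graph \<Rightarrow> ('a \<times> 'a) set" where
  "connected_rel Y =
     {(u, v). u \<in> gverts Y \<and> v \<in> gverts Y \<and> (u, v) \<in> {(x, y). {x, y} \<in> gedges Y}\<^sup>*}"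

definition components :: "'a graph \<Rightarrow> 'a set set" where
  "components Y = gverts Y // connected_rel Y"

definition matching :: "'a set set \<Rightarrow> bool" where
  "matching M \<longleftrightarrow> (\<forall>e \<in> M. card e = 2) \<and> pairwise disjnt M"

definition perfect_matching :: "'a graph \<Rightarrow> 'a set set \<Rightarrow> bool" where
  "perfect_matching Y M \<longleftrightarrow> M \<subseteq> gedges Y \<and> matching M \<and> \<Union>M = gverts Y"

definition isolating_perfect_matching :: "'a graph \<Rightarrow> 'a set set \<Rightarrow> bool" where
  "isolating_perfect_matching Y M \<longleftrightarrow>
     perfect_matching Y M \<and> (\<forall>e \<in> M. \<not> (\<exists>C \<in> components (delete_edges Y M). e \<subseteq> C))"

text \<open>Parallel edges are distinct elements of \<open>edges\<close> with the same set of ends; each edge has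
  exactly two ends, which excludes loops.\<close>

record ('v, 'e) multigraph =
  verts :: "'v set"
  edges :: "'e set"
  ends :: "'e \<Rightarrow> 'v set"

definition is_multigraph :: "('v, 'e) multigraph \<Rightarrow> bool" where
  "is_multigraph X \<longleftrightarrow> (\<forall>e \<in> edges X. ends X e \<subseteq> verts X \<and> card (ends X e) = 2)"

definition no_isolated_vertices :: "('v, 'e) multigraph \<Rightarrow> bool" where
  "no_isolated_vertices X \<longleftrightarrow> (\<forall>v \<in> verts X. \<exists>e \<in> edges X. v \<in> ends X e)"

definition multigraph_iso :: "('v, 'e) multigraph \<Rightarrow> ('w, 'f) multigraph \<Rightarrow> bool" where
  "multigraph_iso X X' \<longleftrightarrow>
     (\<exists>f g. bij_betw f (verts X) (verts X') \<and> bij_betw g (edges X) (edges X') \<and>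
        (\<forall>e \<in> edges X. ends X' (g e) = f ` ends X e))"

definition cluster :: "'a set set \<Rightarrow> ('a \<Rightarrow> 'v) \<Rightarrow> 'v \<Rightarrow> 'a set" where
  "cluster M\<^sub>0 lab v = {x \<in> \<Union>M\<^sub>0. lab x = v}"

definition truncation_data ::
  "('v, 'e) multigraph \<Rightarrow> 'a set set \<Rightarrow> ('e \<Rightarrow> 'a set) \<Rightarrow> ('a \<Rightarrow> 'v) \<Rightarrow> ('v \<Rightarrow> 'a graph) \<Rightarrow> bool"
where
  "truncation_data X M\<^sub>0 F lab con \<longleftrightarrow>
     matching M\<^sub>0 \<and> bij_betw F (edges X) M\<^sub>0 \<and>
     (\<forall>e \<in> edges X. bij_betw lab (F e) (ends X e)) \<and>
     (\<forall>v \<in> verts X. is_graph (con v) \<and> gverts (con v) = cluster M\<^sub>0 lab v)"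

definition truncation_graph ::
  "('v, 'e) multigraph \<Rightarrow> 'a set set \<Rightarrow> ('v \<Rightarrow> 'a graph) \<Rightarrow> 'a graph"
where
  "truncation_graph X M\<^sub>0 con =
     \<lparr>gverts = \<Union>M\<^sub>0, gedges = M\<^sub>0 \<union> (\<Union>v \<in> verts X. gedges (con v))\<rparr>"

text \<open>The new vertices are drawn from the vertex type of \<open>Y\<close>. This is no restriction, since the
  constructed graph has to be isomorphic to \<open>Y\<close>.\<close>

definition generalized_truncation :: "('v, 'e) multigraph \<Rightarrow> 'a graph \<Rightarrow> bool" where
  "generalized_truncation X Y \<longleftrightarrow>
     is_multigraph X \<and> no_isolated_vertices X \<and>
     (\<exists>(M\<^sub>0 :: 'a set set) F lab con.
        truncation_data X M\<^sub>0 F lab con \<and> graph_iso (truncation_graph X M\<^sub>0 con) Y)"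

definition multigraph_iso_rel :: "(('v, 'e) multigraph \<times> ('v, 'e) multigraph) set" where
  "multigraph_iso_rel = {(X, X'). is_multigraph X \<and> is_multigraph X' \<and> multigraph_iso X X'}"

text \<open>The elements of the source are isomorphism classes. The types \<open>'v\<close> and \<open>'e\<close>, from which
  the vertices and edges of the multigraphs are taken, are left arbitrary.\<close>

definition src :: "'a graph \<Rightarrow> ('v, 'e) multigraph set set" where
  "src Y = {X. generalized_truncation X Y} // multigraph_iso_rel"

end

theory Submission
  imports Defs
begin

text \<open>If \<open>Y\<close> is a generalized truncation of \<open>X\<close>, the edges of \<open>X\<close> become an isolating perfect
  matching of \<open>Y\<close>, hence \<open>M\<close>, and the labelling of the vertices of \<open>Y\<close> by vertices of \<open>X\<close> is
  constant on the components of \<open>Y \ M\<close>. As any two components are joined by an edge of \<open>M\<close>, whose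
  ends carry different labels, the labelling also separates components. So the clusters are the
  components of \<open>Y \ M\<close>, and \<open>X\<close> arises from \<open>Y\<close> by contracting them.\<close>

lemma card_quotient_eq_1:
  assumes "equiv A r" "B \<noteq> {}" and related: "\<And>x y. x \<in> B \<Longrightarrow> y \<in> B \<Longrightarrow> (x, y) \<in> r"
  shows "card (B // r) = 1"
proof -
  obtain b where "b \<in> B"
    using \<open>B \<noteq> {}\<close> by blast
  then have "B // r = {r `` {b}}"
    using equiv_class_eq[OF \<open>equiv A r\<close> related] unfolding quotient_def by blast
  then show ?thesis
    by simp
qed

lemma multigraph_iso_refl: "multigraph_iso X X"
  unfolding multigraph_iso_def by (intro exI[of _ id]) simp

lemma multigraph_iso_sym:
  assumes "is_multigraph X" "multigraph_iso X X'"
  shows "multigraph_iso X' X"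
proof -
  obtain f g where f: "bij_betw f (verts X) (verts X')" and g: "bij_betw g (edges X) (edges X')"
    and ends: "\<And>e. e \<in> edges X \<Longrightarrow> ends X' (g e) = f ` ends X e"
    using assms(2) unfolding multigraph_iso_def by blast
  let ?f' = "inv_into (verts X) f" and ?g' = "inv_into (edges X) g"
  have "ends X (?g' e) = ?f' ` ends X' e" if "e \<in> edges X'" for e
  proof -
    have "?g' e \<in> edges X"
      using bij_betw_apply[OF bij_betw_inv_into[OF g] that] .
    moreover from this have "ends X (?g' e) \<subseteq> verts X"
      using assms(1) by (simp add: is_multigraph_def)
    ultimately show ?thesis
      using ends bij_betw_inv_into_right[OF g that] inv_into_image_cancel[OF bij_betw_imp_inj_on[OF f]]
      by metis
  qed
  then show ?thesis
    using bij_betw_inv_into[OF f] bij_betw_inv_into[OF g] unfolding multigraph_iso_def by blast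
qed

lemma multigraph_iso_trans:
  assumes "multigraph_iso X X'" "multigraph_iso X' X''"
  shows "multigraph_iso X X''"
proof -
  obtain f g where f: "bij_betw f (verts X) (verts X')" and g: "bij_betw g (edges X) (edges X')"
    and ends: "\<And>e. e \<in> edges X \<Longrightarrow> ends X' (g e) = f ` ends X e"
    using assms(1) unfolding multigraph_iso_def by blast
  obtain f' g' where f': "bij_betw f' (verts X') (verts X'')"
    and g': "bij_betw g' (edges X') (edges X'')"
    and ends': "\<And>e. e \<in> edges X' \<Longrightarrow> ends X'' (g' e) = f' ` ends X' e"
    using assms(2) unfolding multigraph_iso_def by blast
  have "\<forall>e \<in> edges X. ends X'' ((g' \<circ> g) e) = (f' \<circ> f) ` ends X e"
    using ends ends' bij_betw_apply[OF g] by (simp add: image_comp)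
  then show ?thesis
    using bij_betw_trans[OF f f'] bij_betw_trans[OF g g'] unfolding multigraph_iso_def by blast
qed

lemma equiv_multigraph_iso_rel: "equiv {X. is_multigraph X} multigraph_iso_rel"
proof (rule equivI)
  show "multigraph_iso_rel \<subseteq> {X. is_multigraph X} \<times> {X. is_multigraph X}"
    by (auto simp: multigraph_iso_rel_def)
  show "refl_on {X. is_multigraph X} multigraph_iso_rel"
    by (auto simp: refl_on_def multigraph_iso_rel_def intro: multigraph_iso_refl)
  show "sym multigraph_iso_rel"
    by (auto simp: sym_def multigraph_iso_rel_def intro: multigraph_iso_sym)
  show "trans multigraph_iso_rel"
    by (auto simp: trans_def multigraph_iso_rel_def intro: multigraph_iso_trans)
qed

definition component :: "'a graph \<Rightarrow> 'a \<Rightarrow> 'a set" where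
  "component Y x = connected_rel Y `` {x}"

lemma components_eq_image_component: "components Y = component Y ` gverts Y"
  by (auto simp: components_def quotient_def component_def)

lemma component_refl: "x \<in> gverts Y \<Longrightarrow> x \<in> component Y x"
  by (simp add: component_def connected_rel_def)

lemma component_subset_gverts: "component Y x \<subseteq> gverts Y"
  by (auto simp: component_def connected_rel_def)

lemma gverts_delete_edges [simp]: "gverts (delete_edges Y M) = gverts Y"
  by (simp add: delete_edges_def)

lemma gedges_delete_edges [simp]: "gedges (delete_edges Y M) = gedges Y - M"
  by (simp add: delete_edges_def)

definition contraction :: "'a graph \<Rightarrow> 'a set set \<Rightarrow> ('a set, 'a set) multigraph" where
  "contraction Y M = \<lparr>verts = components (delete_edges Y M), edges = M,
     ends = (\<lambda>e. component (delete_edges Y M) ` e)\<rparr>"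

lemma matching_image:
  assumes "inj_on f (\<Union>M)" "matching M"
  shows "matching ((`) f ` M)"
  unfolding matching_def
proof (intro conjI ballI)
  fix d assume "d \<in> (`) f ` M"
  then obtain e where "e \<in> M" "d = f ` e"
    by blast
  moreover from this have "inj_on f e"
    using inj_on_subset[OF assms(1)] by blast
  ultimately show "card d = 2"
    using assms(2) by (simp add: card_image matching_def)
next
  have "disjnt (f ` d) (f ` e)" if "d \<in> M" "e \<in> M" "d \<noteq> e" for d e
    using disjnt_inj_on_iff[OF assms(1)] assms(2) that
    by (auto simp: matching_def pairwise_def)
  then show "pairwise disjnt ((`) f ` M)"
    by (auto simp: pairwise_def)
qed

lemma perfect_matching_image:
  assumes "bij_betw f (gverts Y) (gverts Z)" "gedges Z = (`) f ` gedges Y" "perfect_matching Y M"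
  shows "perfect_matching Z ((`) f ` M)"
proof -
  have M: "M \<subseteq> gedges Y" "matching M" "\<Union>M = gverts Y"
    using assms(3) by (auto simp: perfect_matching_def)
  then have "matching ((`) f ` M)"
    using assms(1) by (intro matching_image) (auto simp: bij_betw_def)
  moreover have "\<Union>((`) f ` M) = gverts Z"
    using M(3) assms(1) by (simp add: bij_betw_def flip: image_Union)
  ultimately show ?thesis
    using M(1) assms(2) by (auto simp: perfect_matching_def)
qed

locale truncation_labelling =
  fixes X :: "('v, 'e) multigraph" and Y :: "'a graph"
    and M :: "'a set set" and F :: "'e \<Rightarrow> 'a set" and lab :: "'a \<Rightarrow> 'v"
  assumes perfect_matching: "perfect_matching Y M"
    and bij_betw_edges: "bij_betw F (edges X) M"
    and bij_betw_ends: "e \<in> edges X \<Longrightarrow> bij_betw lab (F e) (ends X e)"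
    and label_eq_if_unmatched: "d \<in> gedges Y - M \<Longrightarrow> x \<in> d \<Longrightarrow> y \<in> d \<Longrightarrow> lab x = lab y"
begin

lemma Union_matching: "\<Union>M = gverts Y"
  using perfect_matching by (simp add: perfect_matching_def)

lemma card_matching: "e \<in> M \<Longrightarrow> card e = 2"
  using perfect_matching by (simp add: perfect_matching_def matching_def)

lemma edge_subset_gverts: "e \<in> edges X \<Longrightarrow> F e \<subseteq> gverts Y"
  using bij_betw_apply[OF bij_betw_edges] Union_matching by blast

lemma image_label_edge: "e \<in> edges X \<Longrightarrow> lab ` F e = ends X e"
  using bij_betw_ends by (simp add: bij_betw_def)

lemma label_neq_if_matched:
  assumes "{x, y} \<in> M"
  shows "lab x \<noteq> lab y"
proof -
  obtain e where "e \<in> edges X" "F e = {x, y}"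
    using assms bij_betw_edges by (metis bij_betw_imp_surj_on imageE)
  then have "inj_on lab {x, y}"
    using bij_betw_ends by (metis bij_betw_imp_inj_on)
  moreover have "x \<noteq> y"
    using card_matching[OF assms] by auto
  ultimately show ?thesis
    by simp
qed

lemma label_eq_if_connected:
  assumes "y \<in> component (delete_edges Y M) x"
  shows "lab x = lab y"
proof -
  have "(x, y) \<in> {(x, y). {x, y} \<in> gedges Y - M}\<^sup>*"
    using assms by (simp add: component_def connected_rel_def)
  then show ?thesis
  proof induction
    case (step y z)
    then have "lab y = lab z"
      using label_eq_if_unmatched[of "{y, z}"] by blast
    with step.IH show ?case
      by simp
  qed simp
qed

lemma isolating_perfect_matching: "isolating_perfect_matching Y M"
  unfolding isolating_perfect_matching_def
proof (intro conjI ballI notI)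
  fix e assume "e \<in> M" and "\<exists>C \<in> components (delete_edges Y M). e \<subseteq> C"
  then obtain z where "e \<subseteq> component (delete_edges Y M) z"
    by (auto simp: components_eq_image_component)
  moreover obtain x y where "e = {x, y}"
    using card_matching[OF \<open>e \<in> M\<close>] by (auto simp: card_2_iff)
  ultimately have "lab x = lab y"
    using label_eq_if_connected by (metis insert_subset)
  with \<open>e \<in> M\<close> \<open>e = {x, y}\<close> show False
    using label_neq_if_matched by blast
qed (fact perfect_matching)

lemma image_label_gverts:
  assumes "is_multigraph X" "no_isolated_vertices X"
  shows "lab ` gverts Y = verts X"
proof -
  have "lab ` gverts Y = (\<Union>e \<in> edges X. lab ` F e)"
    by (simp add: image_Union image_image
        flip: Union_matching bij_betw_imp_surj_on[OF bij_betw_edges])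
  also have "\<dots> = (\<Union>e \<in> edges X. ends X e)"
    by (simp add: image_label_edge)
  also have "\<dots> = verts X"
    using assms by (fastforce simp: is_multigraph_def no_isolated_vertices_def)
  finally show ?thesis .
qed

context
  assumes joined: "\<And>C D. C \<in> components (delete_edges Y M) \<Longrightarrow>
    D \<in> components (delete_edges Y M) \<Longrightarrow> C \<noteq> D \<Longrightarrow> \<exists>x \<in> C. \<exists>y \<in> D. {x, y} \<in> M"
begin

lemma cluster_eq_component:
  assumes "x \<in> gverts Y"
  shows "cluster M lab (lab x) = component (delete_edges Y M) x" (is "_ = ?comp x")
proof
  show "?comp x \<subseteq> cluster M lab (lab x)"
    using component_subset_gverts label_eq_if_connected
    by (fastforce simp: cluster_def Union_matching)
  show "cluster M lab (lab x) \<subseteq> ?comp x"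
  proof
    fix y assume "y \<in> cluster M lab (lab x)"
    then have y: "y \<in> gverts Y" "lab y = lab x"
      by (auto simp: cluster_def Union_matching)
    have "?comp x = ?comp y"
    proof (rule ccontr)
      assume "?comp x \<noteq> ?comp y"
      then obtain x' y' where "x' \<in> ?comp x" "y' \<in> ?comp y" "{x', y'} \<in> M"
        using joined[of "?comp x" "?comp y"] \<open>x \<in> gverts Y\<close> y(1)
        by (auto simp: components_eq_image_component)
      then show False
        using y(2) label_eq_if_connected label_neq_if_matched by metis
    qed
    then show "y \<in> ?comp x"
      using y(1) by (simp add: component_refl)
  qed
qed

lemma multigraph_iso_contraction:
  assumes X: "is_multigraph X" "no_isolated_vertices X"
  shows "multigraph_iso X (contraction Y M)"
proof -
  have image_cluster: "cluster M lab ` lab ` A = component (delete_edges Y M) ` A"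
    if "A \<subseteq> gverts Y" for A
    unfolding image_image using that cluster_eq_component by (intro image_cong) auto
  have "inj_on (cluster M lab) (lab ` gverts Y)"
    by (auto simp: inj_on_def cluster_def Union_matching)
  then have "bij_betw (cluster M lab) (verts X) (verts (contraction Y M))"
    using image_cluster[OF order_refl] image_label_gverts[OF X]
    by (simp add: bij_betw_def contraction_def components_eq_image_component)
  moreover have "bij_betw F (edges X) (edges (contraction Y M))"
    using bij_betw_edges by (simp add: contraction_def)
  moreover have "ends (contraction Y M) (F e) = cluster M lab ` ends X e" if "e \<in> edges X" for e
    using image_cluster[OF edge_subset_gverts[OF that]] image_label_edge[OF that]
    by (simp add: contraction_def)
  ultimately show ?thesis
    unfolding multigraph_iso_def by blast
qed

end

lemma truncation_labelling_image:
  assumes "is_graph Y" and f: "bij_betw f (gverts Y) (gverts Z)"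
    and edges: "gedges Z = (`) f ` gedges Y"
  shows "truncation_labelling X Z ((`) f ` M) ((`) f \<circ> F) (lab \<circ> inv_into (gverts Y) f)"
proof
  have inj: "inj_on f (gverts Y)"
    using f by (rule bij_betw_imp_inj_on)
  show "perfect_matching Z ((`) f ` M)"
    using f edges perfect_matching by (rule perfect_matching_image)
  have "inj_on ((`) f) M"
    using inj by (simp add: inj_on_image Union_matching)
  then show "bij_betw ((`) f \<circ> F) (edges X) ((`) f ` M)"
    by (intro bij_betw_trans[OF bij_betw_edges] inj_on_imp_bij_betw)
  show "bij_betw (lab \<circ> inv_into (gverts Y) f) (((`) f \<circ> F) e) (ends X e)"
    if e: "e \<in> edges X" for e
  proof (rule bij_betw_trans)
    show "bij_betw (inv_into (gverts Y) f) (((`) f \<circ> F) e) (F e)"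
      using bij_betw_inv_into_subset[OF f edge_subset_gverts[OF e]] by simp
    show "bij_betw lab (F e) (ends X e)"
      using e by (rule bij_betw_ends)
  qed
  show "(lab \<circ> inv_into (gverts Y) f) x = (lab \<circ> inv_into (gverts Y) f) y"
    if "d \<in> gedges Z - (`) f ` M" and xy: "x \<in> d" "y \<in> d" for d x y
  proof -
    obtain e where e: "e \<in> gedges Y - M" "d = f ` e"
      using \<open>d \<in> gedges Z - (`) f ` M\<close> by (auto simp: edges)
    then have "e \<subseteq> gverts Y"
      using \<open>is_graph Y\<close> by (simp add: is_graph_def)
    then have "inv_into (gverts Y) f ` d = e"
      using e(2) inj by simp
    then show ?thesis
      using xy label_eq_if_unmatched[OF e(1)] by auto
  qed
qed

end

lemma is_graph_truncation_graph:
  assumes "truncation_data X M F lab con"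
  shows "is_graph (truncation_graph X M con)"
  unfolding is_graph_def
proof
  fix e assume "e \<in> gedges (truncation_graph X M con)"
  then consider (matching) "e \<in> M" | (cluster) v where "v \<in> verts X" "e \<in> gedges (con v)"
    by (auto simp: truncation_graph_def)
  then show "e \<subseteq> gverts (truncation_graph X M con) \<and> card e = 2"
  proof cases
    case matching
    then show ?thesis
      using assms by (auto simp: truncation_data_def truncation_graph_def matching_def)
  next
    case cluster
    then have "e \<subseteq> cluster M lab v" "card e = 2"
      using assms by (metis truncation_data_def is_graph_def)+
    then show ?thesis
      by (auto simp: truncation_graph_def cluster_def)
  qed
qed

lemma truncation_labelling_truncation_graph:
  assumes "truncation_data X M F lab con"
  shows "truncation_labelling X (truncation_graph X M con) M F lab"
proof
  show "perfect_matching (truncation_graph X M con) M"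
    using assms by (simp add: truncation_data_def perfect_matching_def truncation_graph_def)
  show "bij_betw F (edges X) M"
    using assms by (simp add: truncation_data_def)
  show "bij_betw lab (F e) (ends X e)" if "e \<in> edges X" for e
    using assms that by (simp add: truncation_data_def)
  show "lab x = lab y"
    if e: "e \<in> gedges (truncation_graph X M con) - M" and xy: "x \<in> e" "y \<in> e" for e x y
  proof -
    obtain v where "v \<in> verts X" "e \<in> gedges (con v)"
      using e by (auto simp: truncation_graph_def)
    then have "e \<subseteq> cluster M lab v"
      using assms by (metis truncation_data_def is_graph_def)
    then show ?thesis
      using xy by (auto simp: cluster_def)
  qed
qed

lemma generalized_truncation_imp_truncation_labelling:
  fixes X :: "('v, 'e) multigraph" and Y :: "'a graph"
  assumes "generalized_truncation X Y"
  shows "\<exists>M F lab. truncation_labelling X Y M F lab"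
proof -
  obtain M :: "'a set set" and F lab con where data: "truncation_data X M F lab con"
    and "graph_iso (truncation_graph X M con) Y"
    using assms unfolding generalized_truncation_def by blast
  then obtain f where "bij_betw f (gverts (truncation_graph X M con)) (gverts Y)"
    "gedges Y = (`) f ` gedges (truncation_graph X M con)"
    unfolding graph_iso_def by blast
  then show ?thesis
    using truncation_labelling.truncation_labelling_image
      [OF truncation_labelling_truncation_graph[OF data] is_graph_truncation_graph[OF data]]
    by  blast
qed

theorem theorem2p8:
  fixes Y :: "'a graph" and M :: "'a set set"
  assumes "is_graph Y"
    and "\<exists>X :: ('v, 'e) multigraph. generalized_truncation X Y"
    and "isolating_perfect_matching Y M"
    and "\<And>N. isolating_perfect_matching Y N \<Longrightarrow> N = M"
    and "\<And>C D. C \<in> components (delete_edges Y M) \<Longrightarrow> D \<in> components (delete_edges Y M) \<Longrightarrow>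
           C \<noteq> D \<Longrightarrow> \<exists>x \<in> C. \<exists>y \<in> D. {x, y} \<in> M"
  shows "card (src Y :: ('v, 'e) multigraph set set) = 1"
proof -
  have iso_contraction: "is_multigraph X \<and> multigraph_iso X (contraction Y M)"
    if "generalized_truncation X Y" for X :: "('v, 'e) multigraph"
  proof -
    obtain N F lab where labelling: "truncation_labelling X Y N F lab"
      using generalized_truncation_imp_truncation_labelling[OF \<open>generalized_truncation X Y\<close>] by blast
    then have "N = M"
      by (intro assms(4) truncation_labelling.isolating_perfect_matching)
    then show ?thesis
      using truncation_labelling.multigraph_iso_contraction[OF labelling] assms(5) that
      by (simp add: generalized_truncation_def)
  qed
  have "(X, X') \<in> multigraph_iso_rel"
    if "generalized_truncation X Y" "generalized_truncation X' Y" for X X' :: "('v, 'e) multigraph"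
    using iso_contraction[OF that(1)] iso_contraction[OF that(2)]
    by (auto simp: multigraph_iso_rel_def intro: multigraph_iso_trans multigraph_iso_sym)
  then show ?thesis
    unfolding src_def using assms(2)
    by (intro card_quotient_eq_1[OF equiv_multigraph_iso_rel]) auto
qed

end
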